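(* The integrality gap of Forest-BCR is at least $\frac32$; that is, for every $\varepsilon>0$ there is a Steiner Forest instance for which the optimum value of Forest-BCR is positive and the minimum cost of a feasible Steiner Forest solution is at least $(\frac32-\varepsilon)$ times the optimum value of Forest-BCR.
   Context: A Steiner Forest instance $(G,c,\mathcal{P})$ consists of an undirected graph $G=(V,E)$, nonnegative edge costs $c:E\to\mathbb{R}_{\ge0}$, and a collection $\mathcal{P}$ of pairs $\{s,t\}\subseteq V$; a feasible solution is $F\subseteq E$ such that $(V,F)$ contains an $s$-$t$ path for every $\{s,t\}\in\mathcal{P}$, of cost $\sum_{e\in F}c(e)$. Let $\overrightarrow{E}$ be obtained by replacing each $\{u,v\}\in E$ by $(u,v),(v,u)$, both of cost $c(\{u,v\})$; $\delta^+(U)$ is the set of directed edges leaving $U$. Forest-BCR: variables $x^r_e$ ($r\in V$, $e\in\overrightarrow{E}$), $z^r_P$ ($r\in V$, $P\in\mathcal{P}$); minimize $\sum_{r\in V}\sum_{e}c(e)x^r_e$ subject to $\sum_{r\in V}z^r_P=1$ for all $P$; $\sum_{e\in\delta^+(U)}x^r_e\ge z^r_P$ for all $r\in V$, $P\in\mathcal{P}$, $U\subseteq V\setminus\{r\}$ with $P\cap U\ne\emptyset$; $x,z\ge0$. The integrality gap is the supremum over instances of the ratio between the minimum cost of a feasible solution and the optimum LP value. *)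

theory Defs
  imports Complex_Main "HOL-Library.Extended_Real"
begin

record 'v steiner_forest =
  verts :: "'v set"
  edges :: "'v set set"
  cost :: "'v set \<Rightarrow> real"
  pairs :: "'v set set"

definition two_subsets :: "'v set \<Rightarrow> 'v set set" where
  "two_subsets V = {{u, v} | u v. u \<in> V \<and> v \<in> V \<and> u \<noteq> v}"

definition steiner_forest_instance :: "'v steiner_forest \<Rightarrow> bool" where
  "steiner_forest_instance I \<longleftrightarrow>
     finite (verts I) \<and>
     edges I \<subseteq> two_subsets (verts I) \<and>
     (\<forall>e\<in>edges I. 0 \<le> cost I e) \<and>
     pairs I \<subseteq> two_subsets (verts I)"

definition is_path :: "'v set \<Rightarrow> 'v set set \<Rightarrow> 'v \<Rightarrow> 'v \<Rightarrow> 'v list \<Rightarrow> bool" where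
  "is_path V F s t p \<longleftrightarrow>
     p \<noteq> [] \<and> hd p = s \<and> last p = t \<and> set p \<subseteq> V \<and> distinct p \<and>
     successively (\<lambda>u v. {u, v} \<in> F) p"

definition feasible_forest :: "'v steiner_forest \<Rightarrow> 'v set set \<Rightarrow> bool" where
  "feasible_forest I F \<longleftrightarrow>
     F \<subseteq> edges I \<and>
     (\<forall>s t. {s, t} \<in> pairs I \<longrightarrow> (\<exists>p. is_path (verts I) F s t p))"

definition forest_cost :: "'v steiner_forest \<Rightarrow> 'v set set \<Rightarrow> real" where
  "forest_cost I F = (\<Sum>e\<in>F. cost I e)"

text \<open>Meaningful for instances with at least one feasible solution; the set of candidates is then
  finite and nonempty.\<close>
definition forest_opt :: "'v steiner_forest \<Rightarrow> real" where
  "forest_opt I = Min {forest_cost I F | F. feasible_forest I F}"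

definition arcs :: "'v steiner_forest \<Rightarrow> ('v \<times> 'v) set" where
  "arcs I = {(u, v). {u, v} \<in> edges I}"

definition arc_cost :: "'v steiner_forest \<Rightarrow> 'v \<times> 'v \<Rightarrow> real" where
  "arc_cost I a = cost I {fst a, snd a}"

definition out_arcs :: "'v steiner_forest \<Rightarrow> 'v set \<Rightarrow> ('v \<times> 'v) set" where
  "out_arcs I U = {(u, v) \<in> arcs I. u \<in> U \<and> v \<notin> U}"

definition bcr_feasible ::
  "'v steiner_forest \<Rightarrow> ('v \<Rightarrow> 'v \<times> 'v \<Rightarrow> real) \<Rightarrow> ('v \<Rightarrow> 'v set \<Rightarrow> real) \<Rightarrow> bool" where
  "bcr_feasible I x z \<longleftrightarrow>
     (\<forall>P\<in>pairs I. (\<Sum>r\<in>verts I. z r P) = 1) \<and>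
     (\<forall>r\<in>verts I. \<forall>P\<in>pairs I. \<forall>U. U \<subseteq> verts I - {r} \<and> P \<inter> U \<noteq> {} \<longrightarrow>
        z r P \<le> (\<Sum>a\<in>out_arcs I U. x r a)) \<and>
     (\<forall>r\<in>verts I. \<forall>a\<in>arcs I. 0 \<le> x r a) \<and>
     (\<forall>r\<in>verts I. \<forall>P\<in>pairs I. 0 \<le> z r P)"

definition bcr_value :: "'v steiner_forest \<Rightarrow> ('v \<Rightarrow> 'v \<times> 'v \<Rightarrow> real) \<Rightarrow> real" where
  "bcr_value I x = (\<Sum>r\<in>verts I. \<Sum>a\<in>arcs I. arc_cost I a * x r a)"

text \<open>If the instance has a feasible forest, the linear program is feasible too, and its values are
  bounded below by 0, so this infimum is the (attained) optimum value.\<close>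
definition bcr_opt :: "'v steiner_forest \<Rightarrow> real" where
  "bcr_opt I = Inf {bcr_value I x | x z. bcr_feasible I x z}"

text \<open>The ratio is only meaningful for instances that have a feasible forest and a positive
  optimum of the linear program. Since instances are finite, vertices in \<^typ>\<open>nat\<close> represent all of
  them up to isomorphism.\<close>
definition bcr_integrality_gap :: ereal where
  "bcr_integrality_gap =
     Sup {ereal (forest_opt I / bcr_opt I) | I :: nat steiner_forest.
            steiner_forest_instance I \<and> (\<exists>F. feasible_forest I F) \<and> 0 < bcr_opt I}"

end

theory Submission
  imports Defs
begin

text \<open>Take the complete bipartite graph with unit costs whose sides are a group of \<open>g\<close> terminals, any
  two of which must be connected, and \<open>g\<close> further pairs \<open>{s\<^sub>i, t\<^sub>i}\<close>. A path from \<open>s\<^sub>i\<close> to \<open>t\<^sub>i\<close> meets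
  the group, so a feasible forest connects all \<open>3g\<close> vertices and costs at least \<open>3g - 1\<close>. In the
  relaxation, the root \<open>s\<^sub>i\<close> sends one unit from \<open>t\<^sub>i\<close> along the \<open>g\<close> paths of length two in equal
  shares; this costs 2, serves \<open>{s\<^sub>i, t\<^sub>i}\<close> completely and every pair of the group to the extent
  \<open>1/g\<close>. Over all roots this is a feasible solution of value \<open>2g\<close>.\<close>

section \<open>Connectivity and edge counting\<close>

lemma doubleton_mem_iff: "{u, v} \<in> {{a, b} |a b. Q a b} \<longleftrightarrow> Q u v \<or> Q v u"
  by (auto simp: doubleton_eq_iff)

lemma successively_rtrancl:
  assumes "successively (\<lambda>u v. {u, v} \<in> F) p" "p \<noteq> []"
  shows "(hd p, last p) \<in> {(u, v). {u, v} \<in> F}\<^sup>*"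
  using assms
proof (induction p)
  case (Cons a p)
  show ?case
  proof (cases p)
    case (Cons b q)
    with Cons.prems Cons.IH have "(b, last p) \<in> {(u, v). {u, v} \<in> F}\<^sup>*" "{a, b} \<in> F"
      by (auto simp: successively_Cons)
    then show ?thesis
      using Cons by (auto intro: converse_rtrancl_into_rtrancl)
  qed simp
qed simp

text \<open>Every vertex other than the root is charged to the last edge of a shortest path from the root.\<close>
lemma card_le_card_edges_if_connected:
  fixes F :: "'v set set"
  assumes "finite F"
    and reach: "\<And>v. v \<in> V \<Longrightarrow> (r, v) \<in> {(u, v). {u, v} \<in> F}\<^sup>*"
  shows "card (V - {r}) \<le> card F"
proof -
  define R where "R = {(u, v). {u, v} \<in> F}"
  define d where "d v = (LEAST n. (r, v) \<in> R ^^ n)" for v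
  have d: "(r, v) \<in> R ^^ d v" if "(r, v) \<in> R\<^sup>*" for v
    using that unfolding d_def by (metis LeastI rtrancl_imp_relpow)
  have "\<exists>u. (u, v) \<in> R \<and> d u < d v" if v: "v \<in> V - {r}" for v
  proof -
    have rv: "(r, v) \<in> R ^^ d v"
      using d reach v by (simp add: R_def)
    with v obtain n where n: "d v = Suc n"
      by (cases "d v") auto
    with rv obtain u where u: "(r, u) \<in> R ^^ n" "(u, v) \<in> R"
      by auto
    from u(1) have "d u \<le> n"
      unfolding d_def by (rule Least_le)
    with u n show ?thesis
      by auto
  qed
  then obtain p where p: "\<And>v. v \<in> V - {r} \<Longrightarrow> (p v, v) \<in> R \<and> d (p v) < d v"
    by metis
  show ?thesis
  proof (rule card_inj_on_le)
    \<comment> \<open>If \<open>{p v, v} = {p w, w}\<close> with \<open>v\<close> and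
      \<open>w\<close> distinct, then \<open>p v = w\<close> and \<open>p w = v\<close>, so each of
      \<open>v\<close> and \<open>w\<close> would be strictly closer to \<open>r\<close> than the
      other.\<close>
    show "inj_on (\<lambda>v. {p v, v}) (V - {r})"
      by (rule inj_onI) (metis doubleton_eq_iff order_less_asym p)
    show "(\<lambda>v. {p v, v}) ` (V - {r}) \<subseteq> F"
      using p by (auto simp: R_def)
  qed (fact assms(1))
qed

section \<open>Lower bounds on the two optima of an arbitrary instance\<close>

lemma steiner_forest_instance_finite_edges:
  assumes "steiner_forest_instance I"
  shows "finite (edges I)"
proof (rule finite_subset)
  show "edges I \<subseteq> Pow (verts I)"
    using assms by (auto simp: steiner_forest_instance_def two_subsets_def)
  show "finite (Pow (verts I))"
    using assms by (simp add: steiner_forest_instance_def)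
qed

lemma steiner_forest_instance_finite_arcs:
  assumes "steiner_forest_instance I"
  shows "finite (arcs I)"
proof (rule finite_subset)
  show "arcs I \<subseteq> verts I \<times> verts I"
    using assms by (fastforce simp: steiner_forest_instance_def two_subsets_def arcs_def doubleton_eq_iff)
  show "finite (verts I \<times> verts I)"
    using assms by (simp add: steiner_forest_instance_def)
qed

text \<open>\<open>Min\<close> is informative only on a finite nonempty set: finiteness comes from
  \<open>F \<subseteq> edges I\<close>, and nonemptiness from \<open>F0\<close>.\<close>

lemma forest_opt_ge:
  assumes I: "steiner_forest_instance I" and feas: "feasible_forest I F0"
    and bound: "\<And>F. feasible_forest I F \<Longrightarrow> c \<le> forest_cost I F"
  shows "c \<le> forest_opt I"
proof -
  have "{forest_cost I F |F. feasible_forest I F} \<subseteq> forest_cost I ` Pow (edges I)"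
    by (auto simp: feasible_forest_def)
  then have fin: "finite {forest_cost I F |F. feasible_forest I F}"
    by (rule finite_subset) (simp add: steiner_forest_instance_finite_edges[OF I])
  moreover have "{forest_cost I F |F. feasible_forest I F} \<noteq> {}"
    using feas by blast
  ultimately show ?thesis
    unfolding forest_opt_def using bound by (auto simp: Min_ge_iff)
qed

text \<open>One cut per root suffices, since the demands \<open>z r P\<close> add up to 1 over the
  roots. The bound keeps the infimum \<open>bcr_opt\<close> away from 0, so that the ratio makes
  sense.\<close>

lemma bcr_value_ge_1:
  assumes I: "steiner_forest_instance I" and P: "P \<in> pairs I"
    and cost: "\<And>e. e \<in> edges I \<Longrightarrow> 1 \<le> cost I e"
    and feas: "bcr_feasible I x z"
  shows "1 \<le> bcr_value I x"
proof -
  have fin: "finite (arcs I)"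
    by (rule steiner_forest_instance_finite_arcs[OF I])
  have x0: "0 \<le> x r a" if "r \<in> verts I" "a \<in> arcs I" for r a
    using feas that by (auto simp: bcr_feasible_def)
  have "P \<in> two_subsets (verts I)"
    using I P by (auto simp: steiner_forest_instance_def)
  then obtain s t where st: "P = {s, t}" "s \<in> verts I" "t \<in> verts I" "s \<noteq> t"
    by (auto simp: two_subsets_def)
  have "1 = (\<Sum>r\<in>verts I. z r P)"
    using feas P by (simp add: bcr_feasible_def)
  also have "\<dots> \<le> (\<Sum>r\<in>verts I. \<Sum>a\<in>arcs I. x r a)"
  proof (rule sum_mono)
    fix r assume r: "r \<in> verts I"
    \<comment> \<open>This cut is admissible for every root: it avoids \<open>r\<close>, and it is
      nonempty even if \<open>r\<close> is an end of \<open>P\<close>.\<close>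
    define U where "U = P - {r}"
    have "U \<subseteq> verts I - {r}" "P \<inter> U \<noteq> {}"
      using st by (auto simp: U_def)
    then have "z r P \<le> (\<Sum>a\<in>out_arcs I U. x r a)"
      using feas r P by (simp add: bcr_feasible_def)
    also have "\<dots> \<le> (\<Sum>a\<in>arcs I. x r a)"
      by (rule sum_mono2[OF fin]) (auto simp: out_arcs_def x0 r)
    finally show "z r P \<le> (\<Sum>a\<in>arcs I. x r a)" .
  qed
  also have "\<dots> \<le> bcr_value I x"
    unfolding bcr_value_def
  proof (intro sum_mono)
    fix r a assume ra: "r \<in> verts I" "a \<in> arcs I"
    then have "1 \<le> arc_cost I a"
      by (auto simp: arc_cost_def arcs_def intro: cost)
    with x0[OF ra] show "x r a \<le> arc_cost I a * x r a"
      by (simp add: mult_le_cancel_right1)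
  qed
  finally show ?thesis .
qed

section \<open>The instance and its fractional solution\<close>

text \<open>The group is \<open>{..<g}\<close>, and \<open>s\<^sub>i = g + i\<close>, \<open>t\<^sub>i = 2g + i\<close> for \<open>i < g\<close>.\<close>
definition gap_instance :: "nat \<Rightarrow> nat steiner_forest" where
  "gap_instance g =
     \<lparr>verts = {..<3 * g}, edges = {{u, v} |u v. u < g \<and> g \<le> v \<and> v < 3 * g}, cost = (\<lambda>_. 1),
      pairs = two_subsets {..<g} \<union> {{s, s + g} |s. g \<le> s \<and> s < 2 * g}\<rparr>"

text \<open>Arcs point towards the root, because the constraints concern arcs leaving sets that
  avoid it. For the root \<open>r\<close> = \<open>s\<^sub>i\<close>, the vertex
  \<open>r + g\<close> is \<open>t\<^sub>i\<close>; vertices other than the \<open>s\<^sub>i\<close>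
  are idle as roots.\<close>

definition gap_x :: "nat \<Rightarrow> nat \<Rightarrow> nat \<times> nat \<Rightarrow> real" where
  "gap_x g r a =
     (if g \<le> r \<and> r < 2 * g \<and> (fst a = r + g \<and> snd a < g \<or> fst a < g \<and> snd a = r)
      then 1 / real g else 0)"

definition gap_z :: "nat \<Rightarrow> nat \<Rightarrow> nat set \<Rightarrow> real" where
  "gap_z g r P =
     (if g \<le> r \<and> r < 2 * g then if P = {r, r + g} then 1 else if P \<subseteq> {..<g} then 1 / real g else 0
      else 0)"

lemma gap_x_nonneg: "0 \<le> gap_x g r a"
  by (simp add: gap_x_def)

lemma gap_instance_ok: "steiner_forest_instance (gap_instance g)"
proof -
  have "{u, v} \<in> two_subsets {..<3 * g}" if "u < 3 * g" "v < 3 * g" "u \<noteq> v" for u v :: nat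
    using that unfolding two_subsets_def by blast
  moreover have "two_subsets {..<g} \<subseteq> two_subsets {..<3 * g}"
    by (auto simp: two_subsets_def) (metis less_le_trans mult_le_mono1 one_le_numeral nat_mult_1)
  ultimately show ?thesis
    by (auto simp: steiner_forest_instance_def gap_instance_def)
qed

lemma arcs_gap_instance:
  "arcs (gap_instance g) = {..<g} \<times> {g..<3 * g} \<union> {g..<3 * g} \<times> {..<g}"
  using doubleton_mem_iff[where Q = "\<lambda>u v. u < g \<and> g \<le> v \<and> v < 3 * g"]
  by (simp add: arcs_def gap_instance_def) auto

section \<open>Integral solutions of the instance\<close>

lemma feasible_gap_instance:
  assumes g: "0 < g"
  shows "feasible_forest (gap_instance g) (edges (gap_instance g))"
  unfolding feasible_forest_def
proof (intro conjI allI impI)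
  let ?I = "gap_instance g"
  have E: "{u, v} \<in> edges ?I" "{v, u} \<in> edges ?I" if "u < g" "g \<le> v" "v < 3 * g" for u v
    using that by (auto simp: gap_instance_def insert_commute)
  fix s t assume "{s, t} \<in> pairs ?I"
  \<comment> \<open>Both ends of a pair lie on the same side, so any vertex of the other side joins
    them by two edges; \<open>g\<close> and \<open>0\<close> serve as such vertices.\<close>
  then consider "s < g" "t < g" "s \<noteq> t" | "g \<le> s" "s < 3 * g" "g \<le> t" "t < 3 * g" "s \<noteq> t"
    using g by (auto simp: gap_instance_def two_subsets_def doubleton_eq_iff)
  then show "\<exists>p. is_path (verts ?I) (edges ?I) s t p"
  proof cases
    case 1
    with g E[of s g] E[of t g] have "is_path (verts ?I) (edges ?I) s t [s, g, t]"
      by (auto simp: is_path_def gap_instance_def)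
    then show ?thesis ..
  next
    case 2
    with g E[of 0 s] E[of 0 t] have "is_path (verts ?I) (edges ?I) s t [s, 0, t]"
      by (auto simp: is_path_def gap_instance_def)
    then show ?thesis ..
  qed
qed simp

text \<open>With unit costs the cost is the number of edges, so it suffices that \<open>F\<close>
  connects all vertices to the group vertex \<open>0\<close>.\<close>

lemma forest_cost_gap_instance_ge:
  assumes g: "0 < g" and F: "feasible_forest (gap_instance g) F"
  shows "3 * real g - 1 \<le> forest_cost (gap_instance g) F"
proof -
  let ?I = "gap_instance g"
  define R where "R = {(u, v). {u, v} \<in> F}"
  have FE: "F \<subseteq> edges ?I"
    using F by (simp add: feasible_forest_def)
  have fin: "finite F"
    using FE steiner_forest_instance_finite_edges[OF gap_instance_ok] by (rule finite_subset)
  have conn: "(s, t) \<in> R\<^sup>*" if "{s, t} \<in> pairs ?I" for s t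
    using F that successively_rtrancl unfolding feasible_forest_def is_path_def R_def by metis
  have group: "(0, u) \<in> R\<^sup>*" if "u < g" for u
  proof (cases "u = 0")
    case False
    with g that have "{0, u} \<in> two_subsets {..<g}"
      unfolding two_subsets_def by blast
    then have "{0, u} \<in> pairs ?I"
      by (simp add: gap_instance_def)
    then show ?thesis
      by (rule conn)
  qed simp
  \<comment> \<open>Only the first edge of the path from \<open>s\<close> to \<open>t\<close>
    matters: by bipartiteness it ends in the group, which is already connected to
    \<open>0\<close>.\<close>
  have outer: "(0, s) \<in> R\<^sup>*" if "{s, t} \<in> pairs ?I" "s \<noteq> t" "g \<le> s" for s t
  proof -
    from conn[OF that(1)] that(2) obtain w where w: "(s, w) \<in> R"
      by (meson converse_rtranclE)
    with FE have "{s, w} \<in> edges ?I"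
      by (auto simp: R_def)
    with that(3) have "w < g"
      by (auto simp: gap_instance_def doubleton_eq_iff)
    moreover have "(w, s) \<in> R"
      using w by (simp add: R_def insert_commute)
    ultimately show ?thesis
      using group by (meson rtrancl.rtrancl_into_rtrancl)
  qed
  have "(0, v) \<in> R\<^sup>*" if v: "v \<in> verts ?I" for v
  proof -
    consider "v < g" | "g \<le> v" "v < 2 * g" | "2 * g \<le> v" "v < 3 * g"
      using v by (auto simp: gap_instance_def) linarith
    then show ?thesis
    proof cases
      case 1
      then show ?thesis by (rule group)
    next
      case 2
      then have "{v, v + g} \<in> pairs ?I"
        by (auto simp: gap_instance_def)
      then show ?thesis
        using 2 g by (intro outer) auto
    next
      case 3
      \<comment> \<open>Here \<open>v\<close> is some \<open>t\<^sub>i\<close> with partner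
        \<open>v - g\<close>. The pair is first put into its defining form, then turned so that
        \<open>v\<close> comes first, as \<open>outer\<close> expects.\<close>
      then have "{v - g, v - g + g} \<in> pairs ?I"
        by (auto simp: gap_instance_def)
      with 3 have "{v, v - g} \<in> pairs ?I"
        by (simp add: insert_commute)
      then show ?thesis
        using 3 g by (intro outer) auto
    qed
  qed
  then have "card (verts ?I - {0}) \<le> card F"
    using card_le_card_edges_if_connected[OF fin] unfolding R_def by metis
  moreover have "card (verts ?I - {0}) = 3 * g - 1"
    using g by (simp add: gap_instance_def)
  moreover have "forest_cost ?I F = real (card F)"
    by (simp add: forest_cost_def gap_instance_def)
  ultimately show ?thesis
    by linarith
qed

lemma forest_opt_gap_instance_ge:
  assumes "0 < g"
  shows "3 * real g - 1 \<le> forest_opt (gap_instance g)"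
  using gap_instance_ok feasible_gap_instance[OF assms] forest_cost_gap_instance_ge[OF assms]
  by (rule forest_opt_ge)

section \<open>The fractional solution: feasibility and value\<close>

lemma bcr_feasible_gap:
  assumes g: "0 < g"
  shows "bcr_feasible (gap_instance g) (gap_x g) (gap_z g)"
  unfolding bcr_feasible_def
proof (intro conjI ballI allI impI)
  let ?I = "gap_instance g"
  have fin: "finite (out_arcs ?I U)" for U
    by (rule finite_subset[OF _ steiner_forest_instance_finite_arcs[OF gap_instance_ok]])
      (auto simp: out_arcs_def)
  have out: "{(u, v)} \<subseteq> out_arcs ?I U"
    if "u \<in> U" "v \<notin> U" "u < g \<and> g \<le> v \<and> v < 3 * g \<or> v < g \<and> g \<le> u \<and> u < 3 * g" for u v U
    using that by (auto simp: out_arcs_def arcs_gap_instance)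
  fix P assume P: "P \<in> pairs ?I"
  show "(\<Sum>r\<in>verts ?I. gap_z g r P) = 1"
  proof (cases "P \<subseteq> {..<g}")
    case True
    have "(\<Sum>r\<in>verts ?I. gap_z g r P) = (\<Sum>r\<in>{g..<2 * g}. 1 / real g)"
      using True by (intro sum.mono_neutral_cong_right) (auto simp: gap_instance_def gap_z_def)
    then show ?thesis
      using g by simp
  next
    case False
    with P obtain s where s: "P = {s, s + g}" "g \<le> s" "s < 2 * g"
      by (auto simp: gap_instance_def two_subsets_def)
    have "(\<Sum>r\<in>verts ?I. gap_z g r P) = (\<Sum>r\<in>{s}. 1)"
      using s by (intro sum.mono_neutral_cong_right)
        (auto simp: gap_instance_def gap_z_def doubleton_eq_iff)
    then show ?thesis
      by simp
  qed
  fix r assume r: "r \<in> verts ?I"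
  fix U assume U: "U \<subseteq> verts ?I - {r} \<and> P \<inter> U \<noteq> {}"
  consider "g \<le> r" "r < 2 * g" "P = {r, r + g}" | "g \<le> r" "r < 2 * g" "P \<subseteq> {..<g}" | "gap_z g r P = 0"
    by (cases "g \<le> r \<and> r < 2 * g"; cases "P = {r, r + g}"; cases "P \<subseteq> {..<g}")
      (simp_all add: gap_z_def)
  then show "gap_z g r P \<le> (\<Sum>a\<in>out_arcs ?I U. gap_x g r a)"
  proof cases
    case 1
    \<comment> \<open>On each path from \<open>r + g\<close> via \<open>u\<close> to
      \<open>r\<close>, \<open>f\<close> picks an arc leaving \<open>U\<close>; there is one because
      \<open>U\<close> contains \<open>r + g\<close> but not \<open>r\<close>. These
      \<open>g\<close> distinct arcs carry \<open>1 / g\<close> each.\<close>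
    define f where "f u = (if u \<in> U then (u, r) else (r + g, u))" for u
    have tU: "r + g \<in> U"
      using 1 U by auto
    have inj: "inj_on f {..<g}"
      using 1 by (auto simp: inj_on_def f_def split: if_splits)
    have f: "f ` {..<g} \<subseteq> out_arcs ?I U"
    proof
      fix a assume "a \<in> f ` {..<g}"
      then obtain u where "u < g" "a = f u"
        by auto
      then show "a \<in> out_arcs ?I U"
        using 1 U tU out[of u U r] out[of "r + g" U u] by (auto simp: f_def)
    qed
    have "gap_z g r P = (\<Sum>u<g. 1 / real g)"
      using 1 g by (simp add: gap_z_def)
    also have "\<dots> = (\<Sum>u<g. gap_x g r (f u))"
      using 1 by (intro sum.cong) (auto simp: gap_x_def f_def)
    also have "\<dots> = (\<Sum>a\<in>f ` {..<g}. gap_x g r a)"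
      by (simp add: sum.reindex[OF inj])
    also have "\<dots> \<le> (\<Sum>a\<in>out_arcs ?I U. gap_x g r a)"
      by (rule sum_mono2[OF fin f]) (simp add: gap_x_nonneg)
    finally show ?thesis .
  next
    case 2
    then obtain u where u: "u \<in> P" "u \<in> U" "u < g"
      using U by auto
    \<comment> \<open>The demand is only \<open>1 / g\<close>, so a single arc meets it: the one
      from a group vertex \<open>u\<close> in \<open>U\<close> straight to the root.\<close>
    have "gap_z g r P = (\<Sum>a\<in>{(u, r)}. gap_x g r a)"
      using 2 u by (auto simp: gap_z_def gap_x_def)
    also have "\<dots> \<le> (\<Sum>a\<in>out_arcs ?I U. gap_x g r a)"
      using 2 u U by (intro sum_mono2[OF fin out]) (auto simp: gap_x_nonneg)
    finally show ?thesis .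
  next
    case 3
    then show ?thesis
      by (simp add: sum_nonneg gap_x_nonneg)
  qed
qed (simp_all add: gap_x_nonneg gap_z_def)

lemma bcr_value_gap:
  assumes g: "0 < g"
  shows "bcr_value (gap_instance g) (gap_x g) = 2 * real g"
proof -
  let ?I = "gap_instance g"
  have row: "(\<Sum>a\<in>arcs ?I. gap_x g r a) = (if r \<in> {g..<2 * g} then 2 else 0)" for r
  proof (cases "r \<in> {g..<2 * g}")
    case True
    \<comment> \<open>The support consists of the \<open>g\<close> arcs from \<open>r + g\<close>
      into the group and the \<open>g\<close> arcs from the group to \<open>r\<close>.\<close>
    have "(\<Sum>a\<in>arcs ?I. gap_x g r a) = (\<Sum>a\<in>{r + g} \<times> {..<g} \<union> {..<g} \<times> {r}. 1 / real g)"
      using True by (intro sum.mono_neutral_cong_right) (auto simp: arcs_gap_instance gap_x_def)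
    also have "\<dots> = (\<Sum>a\<in>{r + g} \<times> {..<g}. 1 / real g) + (\<Sum>a\<in>{..<g} \<times> {r}. 1 / real g)"
      using True by (intro sum.union_disjoint) auto
    also have "\<dots> = 2"
      using g by (simp add: card_cartesian_product)
    finally show ?thesis
      using True by simp
  qed (auto simp: gap_x_def)
  have "bcr_value ?I (gap_x g) = (\<Sum>r\<in>verts ?I. \<Sum>a\<in>arcs ?I. gap_x g r a)"
    by (simp add: bcr_value_def arc_cost_def gap_instance_def)
  also have "\<dots> = (\<Sum>r\<in>{g..<2 * g}. 2)"
    unfolding row by (intro sum.mono_neutral_cong_right) (auto simp: gap_instance_def)
  finally show ?thesis
    by simp
qed

lemma bcr_opt_gap_instance:
  assumes g: "0 < g"
  shows "0 < bcr_opt (gap_instance g)" "bcr_opt (gap_instance g) \<le> 2 * real g"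
proof -
  let ?I = "gap_instance g"
  let ?S = "{bcr_value ?I x |x z. bcr_feasible ?I x z}"
  \<comment> \<open>The pair of \<open>s\<^sub>0\<close> and \<open>t\<^sub>0\<close> is available
    for every positive \<open>g\<close>, whereas the group contributes no pair when
    \<open>g = 1\<close>.\<close>
  have "{g, g + g} \<in> pairs ?I"
    using g by (auto simp: gap_instance_def)
  then have ge: "1 \<le> v" if "v \<in> ?S" for v
    using that bcr_value_ge_1[OF gap_instance_ok, of "{g, g + g}" g]
    by (auto simp: gap_instance_def)
  have mem: "2 * real g \<in> ?S"
    using bcr_feasible_gap[OF g] bcr_value_gap[OF g, symmetric] by blast
  have "1 \<le> bcr_opt ?I"
    unfolding bcr_opt_def using mem ge by (intro cInf_greatest) blast+
  then show "0 < bcr_opt ?I"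
    by simp
  show "bcr_opt ?I \<le> 2 * real g"
    unfolding bcr_opt_def using mem ge by (intro cInf_lower bdd_belowI)
qed

section \<open>The ratio and its limit\<close>

lemma gap_instance_ratio:
  assumes g: "0 < g" and \<epsilon>: "1 / (2 * real g) \<le> \<epsilon>"
  shows "(3 / 2 - \<epsilon>) * bcr_opt (gap_instance g) \<le> forest_opt (gap_instance g)"
proof -
  \<comment> \<open>Multiplying the two bounds requires the larger factor
    \<open>3 / 2 - 1 / (2 * real g)\<close> to be nonnegative; \<open>3 / 2 - \<epsilon>\<close>
    itself may be negative.\<close>
  have "1 \<le> 2 * real g"
    using g by linarith
  then have "1 / (2 * real g) \<le> 3 / 2"
    by (simp add: field_simps)
  then have "(3 / 2 - \<epsilon>) * bcr_opt (gap_instance g) \<le> (3 / 2 - 1 / (2 * real g)) * (2 * real g)"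
    using \<epsilon> bcr_opt_gap_instance[OF g] by (intro mult_mono) auto
  also have "\<dots> = 3 * real g - 1"
    using g by (simp add: field_simps)
  finally show ?thesis
    using forest_opt_gap_instance_ge[OF g] by linarith
qed

theorem theorem4:
  shows "ereal (3 / 2) \<le> bcr_integrality_gap \<and>
    (\<forall>\<epsilon>::real. \<epsilon> > 0 \<longrightarrow>
      (\<exists>I :: nat steiner_forest.
         steiner_forest_instance I \<and> (\<exists>F. feasible_forest I F) \<and>
         0 < bcr_opt I \<and>
         (3 / 2 - \<epsilon>) * bcr_opt I \<le> forest_opt I))"
proof -
  have gap: "\<exists>I :: nat steiner_forest.
      steiner_forest_instance I \<and> (\<exists>F. feasible_forest I F) \<and> 0 < bcr_opt I \<and>
      (3 / 2 - \<epsilon>) * bcr_opt I \<le> forest_opt I" if \<epsilon>: "0 < \<epsilon>" for \<epsilon> :: real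
  proof -
    obtain n where n: "inverse (real (Suc n)) < \<epsilon>"
      using reals_Archimedean[OF \<epsilon>] by blast
    have "1 / (2 * real (Suc n)) \<le> inverse (real (Suc n))"
      by (simp add: field_simps)
    with n have "1 / (2 * real (Suc n)) \<le> \<epsilon>"
      by linarith
    then have "(3 / 2 - \<epsilon>) * bcr_opt (gap_instance (Suc n)) \<le> forest_opt (gap_instance (Suc n))"
      by (intro gap_instance_ratio) simp_all
    moreover have "\<exists>F. feasible_forest (gap_instance (Suc n)) F"
      using feasible_gap_instance[OF zero_less_Suc] ..
    ultimately show ?thesis
      using gap_instance_ok bcr_opt_gap_instance(1)[OF zero_less_Suc] by metis
  qed
  moreover have "ereal (3 / 2) \<le> bcr_integrality_gap"
  \<comment> \<open>The instances only provide ratios of at least \<open>3 / 2 - \<epsilon>\<close>,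
    so the supremum is compared with \<open>3 / 2\<close> up to an arbitrary positive error.\<close>
  proof (rule ereal_le_epsilon2)
    fix \<epsilon> :: real assume "0 < \<epsilon>"
    from gap[OF this] obtain I :: "nat steiner_forest" where
      I: "steiner_forest_instance I \<and> (\<exists>F. feasible_forest I F) \<and> 0 < bcr_opt I"
        "(3 / 2 - \<epsilon>) * bcr_opt I \<le> forest_opt I"
      by metis
    then have "3 / 2 - \<epsilon> \<le> forest_opt I / bcr_opt I"
      by (simp add: pos_le_divide_eq)
    then have "ereal (3 / 2) \<le> ereal (forest_opt I / bcr_opt I) + ereal \<epsilon>"
      by (simp only: plus_ereal.simps ereal_less_eq)
    moreover have "ereal (forest_opt I / bcr_opt I) \<le> bcr_integrality_gap"
      unfolding bcr_integrality_gap_def using I(1) by (intro Sup_upper CollectI exI[of _ I]) simp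
    ultimately show "ereal (3 / 2) \<le> bcr_integrality_gap + ereal \<epsilon>"
      by (rule order_trans[OF _ add_right_mono])
  qed
  ultimately show ?thesis
    by (intro conjI allI impI)
qed

end
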